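(* Let $L\ge2$ be an integer, $\{\!\{z\}\!\}:=\sinh\big(\frac{\pi z}{L+1}\big)$ and $\bar\kappa^{\mathrm{hyp}}=2\cosh\frac{\pi}{L+1}$. The function $x=f(z)=\frac{\{\!\{z\}\!\}}{\{\!\{1-z\}\!\}}$ satisfies, with $x=f(z)$, $x'=f(z')$, $x''=f(z'')$ and $z''=z'-z$ (for generic $z,z'$), $$x''=\frac{x'-x}{1+\bar\kappa^{\mathrm{hyp}}x+xx'}.$$ Consequently $\check R^{\mathrm{hyp}}_A(z,a)=\mathrm{id}+\frac{\{\!\{z\}\!\}}{\{\!\{1-z\}\!\}}T_A^{\mathrm{hyp}}(a)$, where for $a\in\mathbb{Z}+b$ $$T^{\mathrm{hyp}}_A(a)=\frac{\sqrt{\{\!\{a-1\}\!\}\{\!\{a+1\}\!\}}}{\{\!\{a\}\!\}}\big(E_{21}\otimes E_{12}+E_{12}\otimes E_{21}\big)+\frac{\{\!\{a+1\}\!\}}{\{\!\{a\}\!\}}E_{11}\otimes E_{22}+\frac{\{\!\{a-1\}\!\}}{\{\!\{a\}\!\}}E_{22}\otimes E_{11},$$ satisfies the dynamical Yang--Baxter equation: for all $a\in\mathbb{Z}+b$ and generic $z,w\in\mathbb{C}$, $$\check R^{(23)}(z-w,ah^{(1)})\,\check R^{(12)}(z,a)\,\check R^{(23)}(w,ah^{(1)})=\check R^{(12)}(w,a)\,\check R^{(23)}(z,ah^{(1)})\,\check R^{(12)}(z-w,a),$$ with $\check R=\check R_A^{\mathrm{hyp}}$.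
   Context: Fix a generic $b\in\mathbb{C}$ (so that $\{\!\{a\}\!\}\ne0$ for all $a\in\mathbb{Z}+b$). $\pi_A^{\mathrm{unres}}$ is the groupoid of the unoriented graph with vertex set $\mathbb{Z}+b$ and one edge between any two neighbouring numbers: its objects are the vertices, each edge gives two mutually inverse arrows, and all arrows are compositions of these. Write $(a,\pm1)$ for the arrow from $a$ to $a\pm1$. $V=V^{\pi_A^{\mathrm{unres}}}$ is the graded vector space with $V_{(a,-1)}=\mathbb{C}e_{(a,-1)}$, $V_{(a,+1)}=\mathbb{C}e_{(a,+1)}$ for all objects $a$, all other components zero. Tensor products: $(V\otimes W)_\gamma=\bigoplus_{\beta\circ\alpha=\gamma}V_\alpha\otimes W_\beta$ ($\beta\circ\alpha$ defined when $t(\alpha)=s(\beta)$, where $s,t$ denote source and target). For each $a$ the source fiber $\bigoplus_{\alpha\in s^{-1}(a)}(V\otimes V)_\alpha$ is identified with $\mathbb{C}^2\otimes\mathbb{C}^2$ by $e_{(a,\varepsilon_1)}\otimes e_{(a+\varepsilon_1,\varepsilon_2)}\mapsto e_{i_1}\otimes e_{i_2}$, with $i=1$ for $\varepsilon=+1$ and $i=2$ for $\varepsilon=-1$; $E_{ij}$ is the $2\times2$ matrix unit, $E_{ij}e_k=\delta_{jk}e_i$. For a family $X(a)\in\bigoplus_{\alpha\in s^{-1}(a)}\mathrm{End}_{\mathbb{C}}((V\otimes V)_\alpha)$ and $u\otimes v\otimes w\in V_{\alpha_1}\otimes V_{\alpha_2}\otimes V_{\alpha_3}$ with composable arrows and $s(\alpha_1)=a$,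 set $X^{(12)}(a)(u\otimes v\otimes w)=X(a)(u\otimes v)\otimes w$ and $X^{(23)}(ah^{(1)})(u\otimes v\otimes w)=u\otimes X(t(\alpha_1))(v\otimes w)$. *)

theory Defs
  imports "HOL-Analysis.Analysis" "HOL-Library.Function_Algebras"
begin

section \<open>The groupoid of an unoriented graph\<close>

text \<open>
  An unoriented graph is given by its vertex set and a symmetric adjacency relation. Arrows of its
  groupoid are walks modulo insertion and deletion of backtracks \<open>x, y, x\<close>; thus an edge and its
  reverse are mutually inverse and every arrow is a composite of edges.
\<close>

type_synonym 'v graph = "'v set \<times> ('v \<times> 'v) set"
type_synonym 'v arrow = "'v list set"

definition walks :: "'v graph \<Rightarrow> 'v list set" where
  "walks G = {p. p \<noteq> [] \<and> set p \<subseteq> fst G \<and> successively (\<lambda>x y. (x, y) \<in> snd G) p}"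

definition backtrack :: "'v graph \<Rightarrow> ('v list \<times> 'v list) set" where
  "backtrack G = {(p @ [x] @ q, p @ [x, y, x] @ q) |p x y q.
     p @ [x] @ q \<in> walks G \<and> p @ [x, y, x] @ q \<in> walks G}"

definition homot :: "'v graph \<Rightarrow> ('v list \<times> 'v list) set" where
  "homot G = {(p, q) \<in> walks G \<times> walks G. (p, q) \<in> (backtrack G \<union> (backtrack G)\<inverse>)\<^sup>*}"

definition arrows :: "'v graph \<Rightarrow> 'v arrow set" where
  "arrows G = walks G // homot G"

definition src :: "'v arrow \<Rightarrow> 'v" where
  "src \<alpha> = the_elem (hd ` \<alpha>)"

definition tgt :: "'v arrow \<Rightarrow> 'v" where
  "tgt \<alpha> = the_elem (last ` \<alpha>)"

text \<open>\<open>comp_arr G \<beta> \<alpha>\<close> is \<open>\<beta> \<circ> \<alpha>\<close>, i.e. first \<open>\<alpha>\<close>, then \<open>\<beta>\<close>; meaningful if \<open>tgt \<alpha> = src \<beta>\<close>.\<close>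

definition comp_arr :: "'v graph \<Rightarrow> 'v arrow \<Rightarrow> 'v arrow \<Rightarrow> 'v arrow" where
  "comp_arr G \<beta> \<alpha> = (\<Union>p\<in>\<alpha>. \<Union>q\<in>\<beta>. homot G `` {p @ tl q})"

lemma equiv_homot: "equiv (walks G) (homot G)"
proof (rule equivI)
  show "homot G \<subseteq> walks G \<times> walks G" by (auto simp: homot_def)
  show "refl_on (walks G) (homot G)" by (auto simp: homot_def refl_on_def)
  have "sym ((backtrack G \<union> (backtrack G)\<inverse>)\<^sup>*)" by (intro sym_rtrancl sym_Un_converse)
  then show "sym (homot G)" by (auto simp: homot_def sym_def)
  show "trans (homot G)" by (auto simp: homot_def trans_def)
qed

lemma homot_ends:
  assumes "(p, q) \<in> homot G"
  shows "hd p = hd q" "last p = last q"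
proof -
  have "(p, q) \<in> (backtrack G \<union> (backtrack G)\<inverse>)\<^sup>*"
    using assms by (simp add: homot_def)
  then have "hd p = hd q \<and> last p = last q"
  proof (induction rule: rtrancl_induct)
    case (step y z)
    have "hd u = hd v \<and> last u = last v" if "(u, v) \<in> backtrack G" for u v :: "'a list"
      using that by (auto simp: backtrack_def hd_append)
    with step show ?case by (metis UnE converseD)
  qed simp
  then show "hd p = hd q" "last p = last q" by auto
qed

lemma src_class: "p \<in> walks G \<Longrightarrow> src (homot G `` {p}) = hd p"
  and tgt_class: "p \<in> walks G \<Longrightarrow> tgt (homot G `` {p}) = last p"
proof -
  assume p: "p \<in> walks G"
  then have pp: "(p, p) \<in> homot G" using equiv_homot[of G] by (auto simp: equiv_def refl_on_def)
  have "hd ` (homot G `` {p}) = {hd p}" "last ` (homot G `` {p}) = {last p}"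
    using pp by (auto dest: homot_ends intro: rev_image_eqI)
  then show "src (homot G `` {p}) = hd p" "tgt (homot G `` {p}) = last p"
    by (simp_all add: src_def tgt_def)
qed


section \<open>Groupoid-graded vector spaces\<close>

text \<open>
  Graded vector spaces are realised as families of subspaces of a space \<open>'x \<Rightarrow> complex\<close> of functions.
  The algebraic tensor product of function spaces embeds into the functions on the product of the
  index sets via \<open>(u \<otimes> v) (x, y) = u x * v y\<close>.
\<close>

definition fscale :: "complex \<Rightarrow> ('x \<Rightarrow> complex) \<Rightarrow> 'x \<Rightarrow> complex" where
  "fscale c u = (\<lambda>x. c * u x)"

global_interpretation fun_space: vector_space fscale
  by unfold_locales (auto simp: fscale_def fun_eq_iff algebra_simps)

type_synonym ('v, 'x) graded_space = "'v arrow \<Rightarrow> ('x \<Rightarrow> complex) set"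

definition ket :: "'x \<Rightarrow> 'x \<Rightarrow> complex" where
  "ket x = (\<lambda>y. if y = x then 1 else 0)"

definition tensor :: "('x \<Rightarrow> complex) \<Rightarrow> ('y \<Rightarrow> complex) \<Rightarrow> 'x \<times> 'y \<Rightarrow> complex" where
  "tensor u v = (\<lambda>(x, y). u x * v y)"

definition graded_tensor ::
  "'v graph \<Rightarrow> ('v, 'x) graded_space \<Rightarrow> ('v, 'y) graded_space \<Rightarrow> ('v, 'x \<times> 'y) graded_space" where
  "graded_tensor G V W \<gamma> = fun_space.span
     {tensor u v |u v \<alpha> \<beta>. \<alpha> \<in> arrows G \<and> \<beta> \<in> arrows G \<and> tgt \<alpha> = src \<beta> \<and>
        comp_arr G \<beta> \<alpha> = \<gamma> \<and> u \<in> V \<alpha> \<and> v \<in> W \<beta>}"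

definition source_fiber :: "'v graph \<Rightarrow> ('v, 'x) graded_space \<Rightarrow> 'v \<Rightarrow> ('x \<Rightarrow> complex) set" where
  "source_fiber G W a = fun_space.span (\<Union>\<alpha>\<in>{\<alpha> \<in> arrows G. src \<alpha> = a}. W \<alpha>)"


section \<open>The graph on \<open>\<int> + b\<close> and the space \<open>V\<close>\<close>

definition Zplus :: "complex \<Rightarrow> complex set" where
  "Zplus b = range (\<lambda>n::int. of_int n + b)"

definition line :: "complex \<Rightarrow> complex graph" where
  "line b = (Zplus b, {(x, y). x \<in> Zplus b \<and> y \<in> Zplus b \<and> (y = x + 1 \<or> y = x - 1)})"

text \<open>Indices in the type \<open>2\<close> encode signs: \<open>1\<close> stands for \<open>\<epsilon> = +1\<close> and \<open>2\<close> for \<open>\<epsilon> = -1\<close>.\<close>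

definition sgn_of :: "2 \<Rightarrow> complex" where
  "sgn_of i = (if i = 1 then 1 else - 1)"

definition arr :: "complex \<Rightarrow> complex \<Rightarrow> 2 \<Rightarrow> complex arrow" where
  "arr b a i = homot (line b) `` {[a, a + sgn_of i]}"

definition VA :: "complex \<Rightarrow> (complex, complex arrow) graded_space" where
  "VA b \<alpha> = (if \<exists>a\<in>Zplus b. \<exists>i. \<alpha> = arr b a i then fun_space.span {ket \<alpha>} else {0})"

abbreviation VA2 :: "complex \<Rightarrow> (complex, complex arrow \<times> complex arrow) graded_space" where
  "VA2 b \<equiv> graded_tensor (line b) (VA b) (VA b)"

abbreviation VA3 ::
  "complex \<Rightarrow> (complex, complex arrow \<times> complex arrow \<times> complex arrow) graded_space" where
  "VA3 b \<equiv> graded_tensor (line b) (VA b) (VA2 b)"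


section \<open>Dynamical operators\<close>

text \<open>
  For an operator \<open>Y\<close> on the source fiber of \<open>V \<otimes> V\<close> at \<open>a\<close>, \<open>leg12 Y\<close> acts on the source fiber of
  \<open>V \<otimes> V \<otimes> V\<close> at \<open>a\<close>. For a family \<open>X\<close> of operators, \<open>leg23 X\<close> applies \<open>X\<close> at the target of the
  first arrow to the last two factors. The lemmas \<open>leg12_tensor\<close> and \<open>leg23_tensor\<close> give the values
  on homogeneous pure tensors.
\<close>

definition leg12 ::
  "(('x \<times> 'y \<Rightarrow> complex) \<Rightarrow> 'x \<times> 'y \<Rightarrow> complex) \<Rightarrow> ('x \<times> 'y \<times> 'z \<Rightarrow> complex) \<Rightarrow> 'x \<times> 'y \<times> 'z \<Rightarrow> complex" where
  "leg12 Y \<psi> = (\<lambda>(x, y, z). Y (\<lambda>(x', y'). \<psi> (x', y', z)) (x, y))"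

definition leg23 ::
  "('v \<Rightarrow> ('y \<times> 'z \<Rightarrow> complex) \<Rightarrow> 'y \<times> 'z \<Rightarrow> complex) \<Rightarrow>
   ('v arrow \<times> 'y \<times> 'z \<Rightarrow> complex) \<Rightarrow> 'v arrow \<times> 'y \<times> 'z \<Rightarrow> complex" where
  "leg23 X \<psi> = (\<lambda>(x, y, z). X (tgt x) (\<lambda>(y', z'). \<psi> (x, y', z')) (y, z))"

lemma leg12_tensor:
  assumes "Vector_Spaces.linear fscale fscale Y"
  shows "leg12 Y (tensor u (tensor v w)) = (\<lambda>(x, y, z). tensor (Y (tensor u v)) w ((x, y), z))"
proof -
  interpret Y: Vector_Spaces.linear fscale fscale Y by fact
  have "(\<lambda>(x', y'). tensor u (tensor v w) (x', y', z)) = fscale (w z) (tensor u v)" for z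
    by (auto simp: tensor_def fscale_def)
  then have "leg12 Y (tensor u (tensor v w)) (x, y, z) = tensor (Y (tensor u v)) w ((x, y), z)"
    for x y z
    by (simp add: leg12_def Y.scale) (simp add: tensor_def fscale_def)
  then show ?thesis by auto
qed

lemma leg23_tensor:
  assumes "\<And>a. Vector_Spaces.linear fscale fscale (X a)" and "u \<in> VA b \<alpha>"
  shows "leg23 X (tensor u (tensor v w)) = tensor u (X (tgt \<alpha>) (tensor v w))"
proof -
  have u: "u x = 0" if "x \<noteq> \<alpha>" for x
    using assms(2) that
    by (auto simp: VA_def fun_space.span_singleton fscale_def ket_def split: if_splits)
  have "(\<lambda>(y', z'). tensor u (tensor v w) (x, y', z')) = fscale (u x) (tensor v w)" for x
    by (auto simp: tensor_def fscale_def)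
  moreover have "X a (fscale c \<phi>) = fscale c (X a \<phi>)" for a c \<phi>
  proof -
    interpret X: Vector_Spaces.linear fscale fscale "X a" by fact
    show ?thesis by (rule X.scale)
  qed
  ultimately have "leg23 X (tensor u (tensor v w)) (x, y, z) =
      tensor u (X (tgt \<alpha>) (tensor v w)) (x, y, z)" for x y z
    by (cases "x = \<alpha>") (auto simp: leg23_def tensor_def fscale_def u)
  then show ?thesis by auto
qed


section \<open>The identification of source fibers with \<open>\<complex>\<^sup>2 \<otimes> \<complex>\<^sup>2\<close>\<close>

definition basis2 :: "complex \<Rightarrow> complex \<Rightarrow> 2 \<times> 2 \<Rightarrow> complex arrow \<times> complex arrow \<Rightarrow> complex" where
  "basis2 b a p = tensor (ket (arr b a (fst p))) (ket (arr b (a + sgn_of (fst p)) (snd p)))"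

definition coord2 ::
  "complex \<Rightarrow> complex \<Rightarrow> (complex arrow \<times> complex arrow \<Rightarrow> complex) \<Rightarrow> complex^(2 \<times> 2)" where
  "coord2 b a \<psi> = (\<chi> p. \<psi> (arr b a (fst p), arr b (a + sgn_of (fst p)) (snd p)))"

definition op_of_matrix ::
  "complex \<Rightarrow> complex \<Rightarrow> complex^(2 \<times> 2)^(2 \<times> 2) \<Rightarrow>
   (complex arrow \<times> complex arrow \<Rightarrow> complex) \<Rightarrow> complex arrow \<times> complex arrow \<Rightarrow> complex" where
  "op_of_matrix b a M \<psi> = (\<Sum>p\<in>UNIV. fscale ((M *v coord2 b a \<psi>) $ p) (basis2 b a p))"

lemma Zplus_sgn_of [simp]: "a \<in> Zplus b \<Longrightarrow> a + sgn_of i \<in> Zplus b"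
proof -
  assume "a \<in> Zplus b"
  then obtain n :: int where "a = of_int n + b" by (auto simp: Zplus_def)
  then have "a + sgn_of i = of_int (if i = 1 then n + 1 else n - 1) + b" by (simp add: sgn_of_def)
  then show ?thesis unfolding Zplus_def by blast
qed

lemma edge_walk:
  assumes "a \<in> Zplus b"
  shows "[a, a + sgn_of i] \<in> walks (line b)"
proof -
  have "a + sgn_of i = a + 1 \<or> a + sgn_of i = a - 1" by (auto simp: sgn_of_def)
  with assms Zplus_sgn_of[OF assms, of i] show ?thesis
    unfolding walks_def line_def by (simp del: Zplus_sgn_of)
qed

lemma src_arr [simp]: "a \<in> Zplus b \<Longrightarrow> src (arr b a i) = a"
  and tgt_arr [simp]: "a \<in> Zplus b \<Longrightarrow> tgt (arr b a i) = a + sgn_of i"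
  by (simp_all add: arr_def src_class tgt_class edge_walk)

lemma sgn_of_eq [simp]: "sgn_of i = sgn_of j \<longleftrightarrow> i = j"
proof -
  have two: "k = 1 \<or> k = 2" for k :: 2 by (rule exhaust_2)
  have "(1::complex) \<noteq> - 1" by simp
  with two[of i] two[of j] show ?thesis unfolding sgn_of_def by metis
qed

lemma arr_eq_iff:
  assumes "a \<in> Zplus b" "a' \<in> Zplus b"
  shows "arr b a i = arr b a' j \<longleftrightarrow> a = a' \<and> i = j"
  using assms by (metis add_left_cancel sgn_of_eq src_arr tgt_arr)

lemma coord2_basis2:
  assumes "a \<in> Zplus b"
  shows "coord2 b a (basis2 b a p) = axis p 1"
proof -
  have "coord2 b a (basis2 b a p) $ q = axis p 1 $ q" for q
  proof -
    obtain i j k l where pq: "p = (i, j)" "q = (k, l)" by (cases p, cases q)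
    have "coord2 b a (basis2 b a p) $ q = (if k = i then 1 else 0) *
        (if arr b (a + sgn_of k) l = arr b (a + sgn_of i) j then 1 else 0)"
      using assms by (simp add: pq coord2_def basis2_def tensor_def ket_def arr_eq_iff)
    also have "\<dots> = (if k = i \<and> l = j then 1 else 0)"
      using assms by (simp add: arr_eq_iff)
    finally show ?thesis by (simp add: pq axis_def)
  qed
  then show ?thesis by (simp add: vec_eq_iff)
qed

lemma arr_in_arrows: "a \<in> Zplus b \<Longrightarrow> arr b a i \<in> arrows (line b)"
  by (simp add: arr_def arrows_def edge_walk quotientI)

lemma comp_arr_class:
  assumes p: "p \<in> walks G" and q: "q \<in> walks G" and pq: "last p = hd q"
  shows "comp_arr G (homot G `` {q}) (homot G `` {p}) = homot G `` {p @ tl q}"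
proof -
  have join: "u @ tl v \<in> walks G" if "u \<in> walks G" "v \<in> walks G" "last u = hd v" for u v
    using that by (cases v; cases "tl v") (auto simp: walks_def successively_append_iff)
  have bt: "(u @ tl v, u' @ tl v') \<in> homot G"
    if uv: "u \<in> walks G" "v \<in> walks G" "u' \<in> walks G" "v' \<in> walks G" "last u = hd v"
      and s: "(u, u') \<in> backtrack G \<and> v = v' \<or> u = u' \<and> (v, v') \<in> backtrack G" for u v u' v'
  proof -
    have l: "last u' = hd v'"
      using s uv(5) by (auto simp: backtrack_def hd_append)
    have w: "u @ tl v \<in> walks G" "u' @ tl v' \<in> walks G" using join uv l by auto
    have "(u @ tl v, u' @ tl v') \<in> backtrack G"
      using s
    proof
      assume h: "(u, u') \<in> backtrack G \<and> v = v'"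
      then obtain c x y d where e: "u = c @ [x] @ d" "u' = c @ [x, y, x] @ d"
        by (auto simp: backtrack_def)
      have "u @ tl v = c @ [x] @ (d @ tl v)" "u' @ tl v' = c @ [x, y, x] @ (d @ tl v)"
        using e h by auto
      with w show ?thesis unfolding backtrack_def by fastforce
    next
      assume h: "u = u' \<and> (v, v') \<in> backtrack G"
      then obtain c x y d where e: "v = c @ [x] @ d" "v' = c @ [x, y, x] @ d"
        by (auto simp: backtrack_def)
      show ?thesis
      proof (cases c)
        case Nil
        have "u \<noteq> []" "last u = x" using uv e Nil by (auto simp: walks_def)
        then have "u = butlast u @ [x]" by (metis append_butlast_last_id)
        then have "u @ tl v = butlast u @ [x] @ d" "u' @ tl v' = butlast u @ [x, y, x] @ d"
          using e h Nil by (auto simp flip: append.assoc)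
        with w show ?thesis unfolding backtrack_def by fastforce
      next
        case (Cons k c')
        then have "u @ tl v = (u @ c') @ [x] @ d" "u' @ tl v' = (u @ c') @ [x, y, x] @ d"
          using e h by auto
        with w show ?thesis unfolding backtrack_def by fastforce
      qed
    qed
    with w show ?thesis by (auto simp: homot_def)
  qed
  have sy: "(x, y) \<in> homot G \<longleftrightarrow> (y, x) \<in> homot G" for x y
    using equiv_homot[of G] by (meson equivE symE)
  have tr: "(x, y) \<in> homot G \<Longrightarrow> (y, z) \<in> homot G \<Longrightarrow> (x, z) \<in> homot G" for x y z
    using equiv_homot[of G] by (meson equivE transE)
  have rf: "x \<in> walks G \<Longrightarrow> (x, x) \<in> homot G" for x
    by (auto simp: homot_def)
  have bw: "x \<in> walks G \<and> y \<in> walks G" if "(x, y) \<in> backtrack G \<union> (backtrack G)\<inverse>" for x y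
    using that by (auto simp: backtrack_def)
  have left: "(p @ tl q, p' @ tl q) \<in> homot G" if "(p, p') \<in> homot G" for p'
  proof -
    have "(p, p') \<in> (backtrack G \<union> (backtrack G)\<inverse>)\<^sup>*" using that by (simp add: homot_def)
    then have "p' \<in> walks G \<and> last p' = hd q \<and> (p @ tl q, p' @ tl q) \<in> homot G"
    proof (induction rule: rtrancl_induct)
      case base
      then show ?case using p q pq join rf by auto
    next
      case (step y z)
      have yz: "y \<in> walks G" "z \<in> walks G" using bw step.hyps by auto
      then have "(y, z) \<in> homot G" using step.hyps by (auto simp: homot_def)
      then have lz: "last z = hd q" using step.IH homot_ends by metis
      have "(y @ tl q, z @ tl q) \<in> homot G"
        using step.hyps(2) bt[of y q z q] bt[of z q y q] yz q lz step.IH sy by auto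
      with lz yz step.IH tr show ?case by blast
    qed
    then show ?thesis by blast
  qed
  have right: "(p' @ tl q, p' @ tl q') \<in> homot G"
    if "(q, q') \<in> homot G" "p' \<in> walks G" "last p' = hd q" for p' q'
  proof -
    have "(q, q') \<in> (backtrack G \<union> (backtrack G)\<inverse>)\<^sup>*" using that by (simp add: homot_def)
    then have "q' \<in> walks G \<and> last p' = hd q' \<and> (p' @ tl q, p' @ tl q') \<in> homot G"
    proof (induction rule: rtrancl_induct)
      case base
      then show ?case using that q join rf by auto
    next
      case (step y z)
      have yz: "y \<in> walks G" "z \<in> walks G" using bw step.hyps by auto
      then have "(y, z) \<in> homot G" using step.hyps by (auto simp: homot_def)
      then have lz: "last p' = hd z" using step.IH homot_ends by metis
      have "(p' @ tl y, p' @ tl z) \<in> homot G"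
        using step.hyps(2) bt[of p' y p' z] bt[of p' z p' y] yz that lz step.IH sy by auto
      with lz yz step.IH tr show ?case by blast
    qed
    then show ?thesis by blast
  qed
  have key: "homot G `` {p' @ tl q'} = homot G `` {p @ tl q}"
    if "(p, p') \<in> homot G" "(q, q') \<in> homot G" for p' q'
  proof -
    have "p' \<in> walks G" "last p' = hd q"
      using that homot_ends[of p p'] pq by (auto simp: homot_def)
    then have "(p @ tl q, p' @ tl q') \<in> homot G" using left right that tr by blast
    then show ?thesis using equiv_class_eq[OF equiv_homot] by metis
  qed
  show ?thesis
  proof
    show "comp_arr G (homot G `` {q}) (homot G `` {p}) \<subseteq> homot G `` {p @ tl q}"
      unfolding comp_arr_def
    proof (intro UN_least)
      fix p' q' assume "p' \<in> homot G `` {p}" "q' \<in> homot G `` {q}"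
      then show "homot G `` {p' @ tl q'} \<subseteq> homot G `` {p @ tl q}" using key[of p' q'] by simp
    qed
    show "homot G `` {p @ tl q} \<subseteq> comp_arr G (homot G `` {q}) (homot G `` {p})"
      unfolding comp_arr_def using rf[OF p] rf[OF q] by blast
  qed
qed


section \<open>The operators \<open>T\<close> and \<open>R\<close>\<close>

definition hbr :: "nat \<Rightarrow> complex \<Rightarrow> complex" where
  "hbr L z = sinh (of_real pi * z / (of_nat L + 1))"

definition kappa_hyp :: "nat \<Rightarrow> complex" where
  "kappa_hyp L = 2 * cosh (of_real pi / (of_nat L + 1))"

definition f_hyp :: "nat \<Rightarrow> complex \<Rightarrow> complex" where
  "f_hyp L z = hbr L z / hbr L (1 - z)"

definition mat_unit :: "'n \<Rightarrow> 'n \<Rightarrow> complex^'n^'n" where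
  "mat_unit i j = (\<chi> k l. if k = i \<and> l = j then 1 else 0)"

definition kron :: "complex^'n^'n \<Rightarrow> complex^'m^'m \<Rightarrow> complex^('n \<times> 'm)^('n \<times> 'm)" where
  "kron A B = (\<chi> p q. A $ fst p $ fst q * B $ snd p $ snd q)"

definition mscale :: "complex \<Rightarrow> complex^'n^'m \<Rightarrow> complex^'n^'m" where
  "mscale c A = (\<chi> i j. c * A $ i $ j)"

text \<open>
  The square root is multivalued, so \<open>r\<close> is an arbitrary choice of a square root of
  \<open>hbr L (a - 1) * hbr L (a + 1)\<close> for every \<open>a\<close>.
\<close>

definition T_mat :: "nat \<Rightarrow> (complex \<Rightarrow> complex) \<Rightarrow> complex \<Rightarrow> complex^(2 \<times> 2)^(2 \<times> 2)" where
  "T_mat L r a =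
     mscale (r a / hbr L a)
       (kron (mat_unit 2 1) (mat_unit 1 2) + kron (mat_unit 1 2) (mat_unit 2 1))
     + mscale (hbr L (a + 1) / hbr L a) (kron (mat_unit 1 1) (mat_unit 2 2))
     + mscale (hbr L (a - 1) / hbr L a) (kron (mat_unit 2 2) (mat_unit 1 1))"

definition R_hyp ::
  "nat \<Rightarrow> (complex \<Rightarrow> complex) \<Rightarrow> complex \<Rightarrow> complex \<Rightarrow> complex \<Rightarrow>
   (complex arrow \<times> complex arrow \<Rightarrow> complex) \<Rightarrow> complex arrow \<times> complex arrow \<Rightarrow> complex" where
  "R_hyp L r b z a \<psi> = \<psi> + fscale (f_hyp L z) (op_of_matrix b a (T_mat L r a) \<psi>)"

lemma linear_op_of_matrix: "Vector_Spaces.linear fscale fscale (op_of_matrix b a M)"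
proof
  have c: "coord2 b a (\<phi> + \<psi>) = coord2 b a \<phi> + coord2 b a \<psi>"
    "coord2 b a (fscale k \<phi>) = k *s coord2 b a \<phi>" for \<phi> \<psi> k
    by (auto simp: coord2_def fscale_def vec_eq_iff)
  show "op_of_matrix b a M (\<phi> + \<psi>) = op_of_matrix b a M \<phi> + op_of_matrix b a M \<psi>" for \<phi> \<psi>
    by (simp add: op_of_matrix_def c matrix_vector_right_distrib fun_space.scale_left_distrib
        sum.distrib)
  show "op_of_matrix b a M (fscale k \<phi>) = fscale k (op_of_matrix b a M \<phi>)" for k \<phi>
    by (simp add: op_of_matrix_def c vector_scalar_commute fun_space.scale_sum_right)
qed

lemma linear_R_hyp: "Vector_Spaces.linear fscale fscale (R_hyp L r b z a)"
proof -
  interpret M: Vector_Spaces.linear fscale fscale "op_of_matrix b a (T_mat L r a)"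
    by (rule linear_op_of_matrix)
  show ?thesis
    by unfold_locales
      (auto simp: R_hyp_def M.add M.scale fun_space.scale_right_distrib mult.commute)
qed

lemma op_of_matrix_basis2:
  assumes "a \<in> Zplus b"
  shows "op_of_matrix b a M (basis2 b a q) = (\<Sum>p\<in>UNIV. fscale (M $ p $ q) (basis2 b a p))"
proof -
  have "(M *v axis q 1) $ p = M $ p $ q" for p
    by (simp add: matrix_vector_mult_def axis_def if_distrib cong: if_cong)
  then show ?thesis using assms by (simp add: op_of_matrix_def coord2_basis2)
qed

lemma comp_arr_arr:
  assumes "a \<in> Zplus b"
  shows "comp_arr (line b) (arr b (a + sgn_of i) j) (arr b a i)
    = homot (line b) `` {[a, a + sgn_of i, a + sgn_of i + sgn_of j]}"
  using assms by (simp add: arr_def comp_arr_class edge_walk)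

lemma comp_arr_loop:
  assumes a: "a \<in> Zplus b" and "i \<noteq> j"
  shows "comp_arr (line b) (arr b (a + sgn_of i) j) (arr b a i) = homot (line b) `` {[a]}"
proof -
  have "i = 1 \<and> j = 2 \<or> i = 2 \<and> j = 1" using assms exhaust_2 by metis
  then have s: "a + sgn_of i + sgn_of j = a" by (auto simp: sgn_of_def)
  have w: "[a, a + sgn_of i, a] \<in> walks (line b)" "[a] \<in> walks (line b)"
    using a Zplus_sgn_of[OF a, of i]
    by (simp_all add: walks_def line_def) (simp add: sgn_of_def)
  then have "([a], [a, a + sgn_of i, a]) \<in> backtrack (line b)"
    unfolding backtrack_def by force
  then have "([a], [a, a + sgn_of i, a]) \<in> homot (line b)" using w by (auto simp: homot_def)
  then show ?thesis
    using equiv_class_eq[OF equiv_homot] comp_arr_arr[OF a] s by metis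
qed

lemma basis2_in_VA2:
  assumes "a \<in> Zplus b"
  shows "basis2 b a (i, j) \<in> VA2 b (comp_arr (line b) (arr b (a + sgn_of i) j) (arr b a i))"
proof -
  have "ket (arr b c k) \<in> VA b (arr b c k)" if "c \<in> Zplus b" for c k
    using that by (auto simp: VA_def intro: fun_space.span_base)
  then show ?thesis
    unfolding graded_tensor_def basis2_def
    using assms by (intro fun_space.span_base CollectI exI conjI)
      (auto simp: arr_in_arrows)
qed

lemma VA2_generators:
  assumes "\<gamma> \<in> arrows (line b)" "src \<gamma> = a"
  shows "VA2 b \<gamma> \<subseteq> fun_space.span {basis2 b a (i, j) |i j. a \<in> Zplus b \<and>
           comp_arr (line b) (arr b (a + sgn_of i) j) (arr b a i) = \<gamma>}"
proof -
  have "tensor u v \<in> fun_space.span {basis2 b a (i, j) |i j. a \<in> Zplus b \<and>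
           comp_arr (line b) (arr b (a + sgn_of i) j) (arr b a i) = \<gamma>}" (is "_ \<in> ?S")
    if h: "tgt \<alpha> = src \<beta>" "comp_arr (line b) \<beta> \<alpha> = \<gamma>" "u \<in> VA b \<alpha>" "v \<in> VA b \<beta>"
    for u v \<alpha> \<beta>
  proof (cases "u = 0 \<or> v = 0")
    case True
    then have "tensor u v = 0" by (auto simp: tensor_def)
    then show ?thesis by (simp add: fun_space.span_zero)
  next
    case False
    then obtain c i d j where cd: "c \<in> Zplus b" "\<alpha> = arr b c i" "d \<in> Zplus b" "\<beta> = arr b d j"
      using h by (auto simp: VA_def split: if_splits)
    then have d: "d = c + sgn_of i" using h by simp
    have w: "[c, c + sgn_of i, c + sgn_of i + sgn_of j] \<in> walks (line b)"
      using cd d edge_walk[of c b i] edge_walk[of d b j] by (auto simp: walks_def)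
    have "src \<gamma> = c" using h(2) cd d comp_arr_arr[of c b i j] src_class[OF w] by simp
    then have ca: "c = a" using assms by simp
    obtain k l where "u = fscale k (ket \<alpha>)" "v = fscale l (ket \<beta>)"
      using h cd by (auto simp: VA_def fun_space.span_singleton split: if_splits)
    then have "tensor u v = fscale (k * l) (basis2 b a (i, j))"
      using cd d ca by (auto simp: basis2_def tensor_def fscale_def)
    moreover have "basis2 b a (i, j) \<in> ?S"
      using cd d ca h(2) by (intro fun_space.span_base) auto
    ultimately show ?thesis by (simp add: fun_space.span_scale)
  qed
  then show ?thesis
    unfolding graded_tensor_def by (intro fun_space.span_minimal fun_space.subspace_span) auto
qed

text \<open>\<open>T\<close> preserves every \<open>(V \<otimes> V)\<^sub>\<gamma>\<close> with \<open>\<gamma>\<close> starting at \<open>a\<close>, so it does define an element of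
  the direct sum of the spaces of endomorphisms of these components.\<close>

lemma T_mat_graded:
  assumes g: "\<gamma> \<in> arrows (line b)" "src \<gamma> = a" and "\<psi> \<in> VA2 b \<gamma>"
  shows "op_of_matrix b a (T_mat L r a) \<psi> \<in> VA2 b \<gamma>"
proof -
  interpret M: Vector_Spaces.linear fscale fscale "op_of_matrix b a (T_mat L r a)"
    by (rule linear_op_of_matrix)
  have sub: "fun_space.subspace (VA2 b \<gamma>)"
    unfolding graded_tensor_def by (rule fun_space.subspace_span)
  have gen: "op_of_matrix b a (T_mat L r a) (basis2 b a (i, j)) \<in> VA2 b \<gamma>"
    if a: "a \<in> Zplus b" and e: "comp_arr (line b) (arr b (a + sgn_of i) j) (arr b a i) = \<gamma>" for i j
  proof -
    have "fscale (T_mat L r a $ p $ (i, j)) (basis2 b a p) \<in> VA2 b \<gamma>" for p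
    proof (cases "T_mat L r a $ p $ (i, j) = 0")
      case True
      then show ?thesis using fun_space.subspace_0[OF sub] by simp
    next
      case False
      obtain k l where p: "p = (k, l)" by (cases p)
      from False have "i \<noteq> j \<and> k \<noteq> l"
        by (auto simp: p T_mat_def mscale_def kron_def mat_unit_def split: if_splits)
      then have "basis2 b a p \<in> VA2 b \<gamma>"
        using basis2_in_VA2[OF a, of k l] comp_arr_loop[OF a] e p by metis
      then show ?thesis using fun_space.subspace_scale[OF sub] by blast
    qed
    then show ?thesis
      by (simp add: op_of_matrix_basis2[OF a] fun_space.subspace_sum[OF sub])
  qed
  have "\<psi> \<in> fun_space.span {basis2 b a (i, j) |i j. a \<in> Zplus b \<and>
           comp_arr (line b) (arr b (a + sgn_of i) j) (arr b a i) = \<gamma>}"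
    using VA2_generators[OF g] assms(3) by blast
  then show ?thesis
  proof (induction rule: fun_space.span_induct_alt)
    case base
    then show ?case using fun_space.subspace_0[OF sub] by (simp only: M.zero)
  next
    case (step c x y)
    have "op_of_matrix b a (T_mat L r a) (fscale c x + y)
        = fscale c (op_of_matrix b a (T_mat L r a) x) + op_of_matrix b a (T_mat L r a) y"
      by (simp only: M.add M.scale)
    moreover have "op_of_matrix b a (T_mat L r a) x \<in> VA2 b \<gamma>" using step(1) gen by blast
    ultimately show ?case
      using step(2) fun_space.subspace_add[OF sub] fun_space.subspace_scale[OF sub] by metis
  qed
qed

end

theory Submission
  imports Defs
begin

text \<open>
  At each vertex \<open>a\<close>, \<open>T(a)\<close> is \<open>1 / {{a}}\<close> times the symmetric \<open>2 \<times> 2\<close> matrix with diagonal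
  \<open>{{a + 1}}, {{a - 1}}\<close> and off-diagonal entry \<open>\<surd>({{a - 1}} {{a + 1}})\<close>, acting on the two walks
  \<open>a, a \<plusminus> 1, a\<close>. Its determinant vanishes, so it has rank one; its trace is \<open>\<kappa>\<close>, because
  \<open>{{a + 1}} + {{a - 1}} = \<kappa> {{a}}\<close>. Consequently the two legs \<open>A = T\<^sup>(\<^sup>1\<^sup>2\<^sup>)\<close> and \<open>B = T\<^sup>(\<^sup>2\<^sup>3\<^sup>)\<close>
  satisfy the Temperley--Lieb relations \<open>A\<^sup>2 = \<kappa> A\<close>, \<open>B\<^sup>2 = \<kappa> B\<close>, \<open>A B A = A\<close>, \<open>B A B = B\<close> on the
  source fiber (\<open>temperley_lieb_source_fiber\<close>). The first two follow from rank one and trace. In the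
  last two, only one intermediate walk survives, and the two diagonal entries picked up along it,
  \<open>{{a \<plusminus> 1}} / {{a}}\<close> at \<open>a\<close> and \<open>{{a}} / {{a \<plusminus> 1}}\<close> at the neighbour \<open>a \<plusminus> 1\<close>, are inverse to each other.

  Given these relations, expanding both sides of
  \<open>(1 + u B) (1 + v A) (1 + w B) = (1 + w A) (1 + v B) (1 + u A)\<close> leaves the single scalar condition
  \<open>u + w + \<kappa> u w + u v w = v\<close>, that is, \<open>u = (v - w) / (1 + \<kappa> w + w v)\<close>. For \<open>u = f(z - w)\<close>, \<open>v = f(z)\<close>,
  \<open>w = f(w)\<close> this is the subtraction formula \<open>f_hyp_diff\<close>, which comes from the addition formulas of
  the hyperbolic functions.
\<close>

section \<open>The subtraction formula for \<open>f\<close>\<close>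

lemma hbr_add: "hbr L (x + y) = hbr L x * cosh (of_real pi * y / (of_nat L + 1))
    + cosh (of_real pi * x / (of_nat L + 1)) * hbr L y"
  by (simp add: hbr_def distrib_left add_divide_distrib sinh_add)

lemma hbr_diff: "hbr L (x - y) = hbr L x * cosh (of_real pi * y / (of_nat L + 1))
    - cosh (of_real pi * x / (of_nat L + 1)) * hbr L y"
  by (simp add: hbr_def right_diff_distrib diff_divide_distrib sinh_diff)

lemma hbr_neighbours: "hbr L (a + 1) + hbr L (a - 1) = kappa_hyp L * hbr L a"
  by (simp add: hbr_add hbr_diff kappa_hyp_def)

lemma cosh_hbr: "(cosh (of_real pi * x / (of_nat L + 1)))\<^sup>2 = 1 + (hbr L x)\<^sup>2"
  by (simp add: hbr_def cosh_square_eq)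

lemma hbr_exchange: "hbr L z' * hbr L (1 - z) - hbr L z * hbr L (1 - z') = hbr L 1 * hbr L (z' - z)"
  by (simp add: hbr_diff algebra_simps)

text \<open>
  By \<open>hbr_neighbours\<close>, the first two summands combine to \<open>{{1 + z}} {{1 - z'}}\<close>, and the claim becomes
  an instance of the exchange relation for \<open>sinh\<close>. It is what makes the denominator
  \<open>1 + \<kappa> x + x x'\<close> nonzero.
\<close>

lemma hbr_denominator:
  "hbr L (1 - z) * hbr L (1 - z') + kappa_hyp L * hbr L z * hbr L (1 - z') + hbr L z * hbr L z'
    = hbr L 1 * hbr L (1 - (z' - z))"
proof -
  \<comment> \<open>Both sides become polynomials in \<open>sinh\<close> and \<open>cosh\<close> of the images of \<open>1\<close>, \<open>z\<close>, \<open>z'\<close>, equal modulo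
    \<open>cosh\<^sup>2 = 1 + sinh\<^sup>2\<close> at \<open>1\<close>.\<close>
  have e: "hbr L (1 - (z' - z)) = hbr L ((1 + z) - z')" by (simp add: algebra_simps)
  have "cosh (of_real pi * (1 + z) / (of_nat L + 1)) =
    cosh (of_real pi * 1 / (of_nat L + 1)) * cosh (of_real pi * z / (of_nat L + 1)) + hbr L 1 * hbr L z"
    by (simp add: hbr_def distrib_left add_divide_distrib cosh_add)
  then show ?thesis
    unfolding e using cosh_hbr[of 1 L]
    by (simp add: hbr_diff hbr_add kappa_hyp_def) algebra
qed

lemma hbr_1_nonzero: "hbr L 1 \<noteq> 0"
proof -
  have "complex_of_real pi * 1 / (of_nat L + 1) = of_real (pi / (real L + 1))" by simp
  then have "hbr L 1 = of_real (sinh (pi / (real L + 1)))"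
    unfolding hbr_def sinh_field_def by (simp only: exp_of_real flip: of_real_minus) simp
  moreover have "sinh (pi / (real L + 1)) \<noteq> 0"
    by (simp add: add_nonneg_eq_0_iff)
  ultimately show ?thesis by simp
qed

lemma f_hyp_diff:
  assumes "hbr L (1 - z) \<noteq> 0" "hbr L (1 - z') \<noteq> 0" "hbr L (1 - (z' - z)) \<noteq> 0"
  shows "1 + kappa_hyp L * f_hyp L z + f_hyp L z * f_hyp L z' \<noteq> 0"
    and "f_hyp L (z' - z) = (f_hyp L z' - f_hyp L z) /
      (1 + kappa_hyp L * f_hyp L z + f_hyp L z * f_hyp L z')"
proof -
  define N where "N = hbr L (1 - z) * hbr L (1 - z')"
  have N: "N \<noteq> 0" using assms by (simp add: N_def)
  have d: "1 + kappa_hyp L * f_hyp L z + f_hyp L z * f_hyp L z' = hbr L 1 * hbr L (1 - (z' - z)) / N"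
    unfolding hbr_denominator[symmetric] N_def using assms
    by (simp add: f_hyp_def divide_simps) (simp add: algebra_simps)
  have n: "f_hyp L z' - f_hyp L z = hbr L 1 * hbr L (z' - z) / N"
    unfolding hbr_exchange[symmetric] N_def using assms
    by (simp add: f_hyp_def divide_simps)
  show "1 + kappa_hyp L * f_hyp L z + f_hyp L z * f_hyp L z' \<noteq> 0"
    unfolding d using assms N hbr_1_nonzero by simp
  show "f_hyp L (z' - z) = (f_hyp L z' - f_hyp L z) /
      (1 + kappa_hyp L * f_hyp L z + f_hyp L z * f_hyp L z')"
    unfolding d n using assms N hbr_1_nonzero by (simp add: f_hyp_def)
qed

section \<open>Yang--Baxter from Temperley--Lieb\<close>

text \<open>
  The mixed terms \<open>u v B A\<close> and \<open>v w A B\<close> agree on both sides, and the relations turn every other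
  nonlinear term into a multiple of \<open>A\<close> or \<open>B\<close>. The relations are required at the single vector \<open>\<psi>\<close>:
  they hold on the source fiber but fail on the ambient function space, where the last arrow
  of a triple may fail to be an edge at the right vertex.
\<close>

lemma temperley_lieb_yang_baxter:
  assumes "Vector_Spaces.linear fscale fscale A" "Vector_Spaces.linear fscale fscale B"
    and rel: "A (A \<psi>) = fscale \<kappa> (A \<psi>)" "B (B \<psi>) = fscale \<kappa> (B \<psi>)"
      "A (B (A \<psi>)) = A \<psi>" "B (A (B \<psi>)) = B \<psi>"
    and v: "u + w + \<kappa> * u * w + u * v * w = v"
  defines "RA \<equiv> \<lambda>c \<phi>. \<phi> + fscale c (A \<phi>)" and "RB \<equiv> \<lambda>c \<phi>. \<phi> + fscale c (B \<phi>)"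
  shows "RB u (RA v (RB w \<psi>)) = RA w (RB v (RA u \<psi>))"
proof -
  interpret A: Vector_Spaces.linear fscale fscale A by fact
  interpret B: Vector_Spaces.linear fscale fscale B by fact
  have "RB u (RA v (RB w \<psi>)) = \<psi> + fscale (u + w + \<kappa> * u * w + u * v * w) (B \<psi>) + fscale v (A \<psi>)
      + fscale (u * v) (B (A \<psi>)) + fscale (v * w) (A (B \<psi>))"
    unfolding RA_def RB_def A.add B.add A.scale B.scale rel
    by (simp add: fscale_def fun_eq_iff algebra_simps)
  moreover have "RA w (RB v (RA u \<psi>)) = \<psi> + fscale (u + w + \<kappa> * u * w + u * v * w) (A \<psi>) + fscale v (B \<psi>)
      + fscale (u * v) (B (A \<psi>)) + fscale (v * w) (A (B \<psi>))"
    unfolding RA_def RB_def A.add B.add A.scale B.scale rel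
    by (simp add: fscale_def fun_eq_iff algebra_simps)
  ultimately show ?thesis unfolding v by (simp add: add_ac)
qed

section \<open>Legs of dynamical operators\<close>

lemma linear_leg12:
  assumes "Vector_Spaces.linear fscale fscale Y"
  shows "Vector_Spaces.linear fscale fscale (leg12 Y)"
proof -
  interpret Y: Vector_Spaces.linear fscale fscale Y by fact
  have a: "(\<lambda>(x', y'). \<phi> (x', y', z) + \<psi> (x', y', z)) = (\<lambda>(x', y'). \<phi> (x', y', z)) + (\<lambda>(x', y'). \<psi> (x', y', z))"
    and s: "(\<lambda>(x', y'). fscale c \<phi> (x', y', z)) = fscale c (\<lambda>(x', y'). \<phi> (x', y', z))"
    for \<phi> \<psi> :: "'a \<times> 'b \<times> 'c \<Rightarrow> complex" and c z
    by (auto simp: fscale_def)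
  show ?thesis
    by unfold_locales (simp_all add: leg12_def a s Y.add Y.scale fun_eq_iff, simp_all add: fscale_def)
qed

lemma linear_leg23:
  assumes "\<And>a. Vector_Spaces.linear fscale fscale (X a)"
  shows "Vector_Spaces.linear fscale fscale (leg23 X)"
proof -
  interpret X: Vector_Spaces.linear fscale fscale "X a" for a by fact
  have a: "(\<lambda>(y', z'). \<phi> (x, y', z') + \<psi> (x, y', z')) = (\<lambda>(y', z'). \<phi> (x, y', z')) + (\<lambda>(y', z'). \<psi> (x, y', z'))"
    and s: "(\<lambda>(y', z'). fscale c \<phi> (x, y', z')) = fscale c (\<lambda>(y', z'). \<phi> (x, y', z'))"
    for \<phi> \<psi> :: "'a arrow \<times> 'b \<times> 'c \<Rightarrow> complex" and c x
    by (auto simp: fscale_def)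
  show ?thesis
    by unfold_locales (simp_all add: leg23_def a s X.add X.scale fun_eq_iff, simp_all add: fscale_def)
qed

lemma leg12_R_hyp:
  "leg12 (R_hyp L r b z a) \<psi> = \<psi> + fscale (f_hyp L z) (leg12 (op_of_matrix b a (T_mat L r a)) \<psi>)"
  by (auto simp: leg12_def R_hyp_def fscale_def)

lemma leg23_R_hyp:
  "leg23 (R_hyp L r b z) \<psi>
    = \<psi> + fscale (f_hyp L z) (leg23 (\<lambda>a. op_of_matrix b a (T_mat L r a)) \<psi>)"
  by (auto simp: leg23_def R_hyp_def fscale_def)

lemma tensor_sum_right: "tensor w (\<Sum>p\<in>I. g p) = (\<Sum>p\<in>I. tensor w (g p))"
  by (induction I rule: infinite_finite_induct) (auto simp: tensor_def fun_eq_iff algebra_simps)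

lemma tensor_fscale_right: "tensor w (fscale c v) = fscale c (tensor w v)"
  by (auto simp: tensor_def fscale_def)

section \<open>Three-step paths span the source fiber\<close>

definition path3 :: "complex \<Rightarrow> complex \<Rightarrow> 2 \<Rightarrow> 2 \<Rightarrow> 2 \<Rightarrow>
    complex arrow \<times> complex arrow \<times> complex arrow \<Rightarrow> complex" where
  "path3 b a i j k = tensor (ket (arr b a i)) (basis2 b (a + sgn_of i) (j, k))"

lemma src_comp_arr:
  assumes "\<alpha> \<in> arrows G" "\<beta> \<in> arrows G" "tgt \<alpha> = src \<beta>"
  shows "src (comp_arr G \<beta> \<alpha>) = src \<alpha>"
proof -
  obtain p q where pq: "p \<in> walks G" "\<alpha> = homot G `` {p}" "q \<in> walks G" "\<beta> = homot G `` {q}"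
    using assms by (auto simp: arrows_def elim!: quotientE)
  have l: "last p = hd q" using assms(3) pq by (simp add: src_class tgt_class)
  have "p @ tl q \<in> walks G"
    using pq l by (cases q; cases "tl q") (auto simp: walks_def successively_append_iff)
  moreover have "hd (p @ tl q) = hd p" using pq by (auto simp: walks_def)
  ultimately show ?thesis using pq l by (simp add: comp_arr_class src_class)
qed

lemma source_fiber_paths:
  "source_fiber (line b) (VA3 b) a
    \<subseteq> fun_space.span {path3 b a i j k |i j k. a \<in> Zplus b}" (is "_ \<subseteq> ?S")
proof -
  have "tensor u v \<in> ?S"
    if h: "\<alpha> \<in> arrows (line b)" "\<beta> \<in> arrows (line b)" "tgt \<alpha> = src \<beta>"
      "src (comp_arr (line b) \<beta> \<alpha>) = a" "u \<in> VA b \<alpha>" "v \<in> VA2 b \<beta>" for u v \<alpha> \<beta>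
  proof (cases "u = 0")
    case True
    then have "tensor u v = 0" by (auto simp: tensor_def)
    then show ?thesis by (simp add: fun_space.span_zero)
  next
    case False
    then obtain c i where c: "c \<in> Zplus b" "\<alpha> = arr b c i"
      using h by (auto simp: VA_def split: if_splits)
    have ca: "c = a" using src_comp_arr[OF h(1-3)] h(4) c by simp
    obtain k where u: "u = fscale k (ket \<alpha>)"
      using h(5) c by (auto simp: VA_def fun_space.span_singleton split: if_splits)
    have sb: "src \<beta> = a + sgn_of i" using h(3) c ca by simp
    have "v \<in> fun_space.span {basis2 b (a + sgn_of i) (j, k) |j k. a + sgn_of i \<in> Zplus b \<and>
        comp_arr (line b) (arr b (a + sgn_of i + sgn_of j) k) (arr b (a + sgn_of i) j) = \<beta>}"
      using VA2_generators[OF h(2) sb] h(6) by blast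
    then show ?thesis
    proof (induction rule: fun_space.span_induct_alt)
      case base
      have "tensor u (0 :: complex arrow \<times> complex arrow \<Rightarrow> complex) = 0" by (auto simp: tensor_def)
      then show ?case by (simp only: fun_space.span_zero)
    next
      case (step d x y)
      then obtain j l where x: "x = basis2 b (a + sgn_of i) (j, l)" by blast
      have "tensor u (fscale d x + y) = fscale (d * k) (path3 b a i j l) + tensor u y"
        unfolding x u path3_def c ca by (auto simp: tensor_def fscale_def algebra_simps)
      moreover have "path3 b a i j l \<in> ?S" using c ca by (intro fun_space.span_base) blast
      ultimately show ?case
        using step(2) by (simp only: fun_space.span_add fun_space.span_scale)
    qed
  qed
  then have "VA3 b \<gamma> \<subseteq> ?S" if "src \<gamma> = a" for \<gamma>
    using that unfolding graded_tensor_def[of "line b" "VA b" "VA2 b"]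
    by (intro fun_space.span_minimal fun_space.subspace_span) blast
  then show ?thesis
    unfolding source_fiber_def by (intro fun_space.span_minimal fun_space.subspace_span) blast
qed

section \<open>The Temperley--Lieb relations\<close>

text \<open>The pairs \<open>(i, opp i)\<close> are the two-step walks returning to their starting vertex; \<open>T\<close> vanishes
  on the other two-step walks.\<close>

definition opp :: "2 \<Rightarrow> 2" where
  "opp i = (if i = 1 then 2 else 1)"

lemma opp_simps [simp]: "opp i \<noteq> i" "i \<noteq> opp i" "opp (opp i) = i" "opp i = opp j \<longleftrightarrow> i = j"
  "opp i = j \<longleftrightarrow> j \<noteq> i" "sgn_of (opp i) = - sgn_of i"
  using exhaust_2[of i] exhaust_2[of j] by (auto simp: opp_def sgn_of_def)

text \<open>The coefficient of \<open>(p, opp p)\<close> in the image of \<open>(i, opp i)\<close> under \<open>T(a)\<close>.\<close>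

definition T_entry :: "nat \<Rightarrow> (complex \<Rightarrow> complex) \<Rightarrow> complex \<Rightarrow> 2 \<Rightarrow> 2 \<Rightarrow> complex" where
  "T_entry L r a p i = (if p = i then hbr L (a + sgn_of i) else r a) / hbr L a"

lemma T_basis2:
  assumes "a \<in> Zplus b"
  shows "op_of_matrix b a (T_mat L r a) (basis2 b a (i, j)) =
    (if j = i then 0 else \<Sum>p\<in>UNIV. fscale (T_entry L r a p i) (basis2 b a (p, opp p)))"
proof -
  have U: "(UNIV :: (2 \<times> 2) set) = {(1, 1), (1, 2), (2, 1), (2, 2)}"
    using exhaust_2 by auto
  show ?thesis
    unfolding op_of_matrix_basis2[OF assms]
    using exhaust_2[of i] exhaust_2[of j]
    by (auto simp: U sum_2 T_entry_def T_mat_def mscale_def kron_def mat_unit_def opp_def sgn_of_def)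
qed

lemma leg23_T_path3:
  assumes "a \<in> Zplus b"
  shows "leg23 (\<lambda>a. op_of_matrix b a (T_mat L r a)) (path3 b a i j k) =
    (if k = j then 0 else \<Sum>p\<in>UNIV. fscale (T_entry L r (a + sgn_of i) p j) (path3 b a i p (opp p)))"
proof -
  have k: "ket (arr b a i) \<in> VA b (arr b a i)"
    using assms by (auto simp: VA_def intro: fun_space.span_base)
  have "leg23 (\<lambda>a. op_of_matrix b a (T_mat L r a)) (path3 b a i j k) =
    tensor (ket (arr b a i)) (op_of_matrix b (a + sgn_of i) (T_mat L r (a + sgn_of i))
      (basis2 b (a + sgn_of i) (j, k)))"
    unfolding path3_def basis2_def[of b "a + sgn_of i" "(j, k)"]
    using assms by (subst leg23_tensor[OF linear_op_of_matrix k]) simp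
  then show ?thesis
    using assms by (auto simp: T_basis2 tensor_sum_right tensor_fscale_right path3_def)
      (simp add: tensor_def fun_eq_iff)
qed

text \<open>
  After a two-step loop the third arrow starts at \<open>a\<close>, whichever loop it is. So all paths on the
  right share the third arrow of the path on the left.
\<close>

lemma leg12_T_path3:
  assumes "a \<in> Zplus b"
  shows "leg12 (op_of_matrix b a (T_mat L r a)) (path3 b a i j k) =
    (if j = i then 0 else \<Sum>p\<in>UNIV. fscale (T_entry L r a p i) (path3 b a p (opp p) k))"
proof -
  have e: "leg12 (op_of_matrix b a (T_mat L r a)) (path3 b a i j k) =
    (\<lambda>(x, y, z). tensor (op_of_matrix b a (T_mat L r a) (basis2 b a (i, j)))
      (ket (arr b (a + sgn_of i + sgn_of j) k)) ((x, y), z))"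
    unfolding path3_def basis2_def fst_conv snd_conv
    by (rule leg12_tensor[OF linear_op_of_matrix])
  show ?thesis
  proof (cases "j = i")
    case True
    then show ?thesis unfolding e using assms by (auto simp: T_basis2 tensor_def)
  next
    case False
    then have "j = opp i" by (metis opp_simps(5))
    have "op_of_matrix b a (T_mat L r a) (basis2 b a (i, j)) =
      (\<Sum>p\<in>UNIV. fscale (T_entry L r a p i) (basis2 b a (p, opp p)))"
      using assms False by (simp add: T_basis2)
    then show ?thesis
      unfolding e using \<open>j = opp i\<close>
      by (auto simp: sum_2 path3_def basis2_def tensor_def fscale_def fun_eq_iff algebra_simps)
  qed
qed

text \<open>
  On three-step paths the relations use three properties of the \<open>2 \<times> 2\<close> matrices \<open>T_entry\<close>: rank one,
  trace \<open>\<kappa>\<close>, and the reciprocity of diagonal entries at neighbouring vertices.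
\<close>

context
  fixes L :: nat and b :: complex and r :: "complex \<Rightarrow> complex"
  assumes generic_b: "\<forall>a\<in>Zplus b. hbr L a \<noteq> 0"
    and root: "\<forall>a\<in>Zplus b. (r a)\<^sup>2 = hbr L (a - 1) * hbr L (a + 1)"
begin

lemma T_entry_rank_one:
  assumes "a \<in> Zplus b"
  shows "T_entry L r a p k * T_entry L r a k i = T_entry L r a k k * T_entry L r a p i"
  using exhaust_2[of p] exhaust_2[of k] exhaust_2[of i] root[rule_format, OF assms]
  by (auto simp: T_entry_def sgn_of_def power2_eq_square)

lemma T_entry_trace:
  assumes "a \<in> Zplus b"
  shows "(\<Sum>k\<in>UNIV. T_entry L r a k k) = kappa_hyp L"
  using assms generic_b hbr_neighbours[of L a]
  by (simp add: sum_2 T_entry_def sgn_of_def flip: add_divide_distrib)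

lemma T_entry_inverse:
  assumes "a \<in> Zplus b"
  shows "T_entry L r (a + sgn_of k) (opp k) (opp k) * T_entry L r a k k = 1"
  using assms generic_b by (simp add: T_entry_def)

abbreviation T12 where "T12 a \<equiv> leg12 (op_of_matrix b a (T_mat L r a))"
abbreviation T23 where "T23 \<equiv> leg23 (\<lambda>a. op_of_matrix b a (T_mat L r a))"

text \<open>
  Rank one means that the images of the two loops are proportional. In this form the coefficient
  \<open>T_entry L r a p i\<close> of an intermediate path is traded for a diagonal entry, and the start of the
  intermediate path for that of the original one.
\<close>

lemma T12_path3_proportional:
  assumes "a \<in> Zplus b"
  shows "fscale (T_entry L r a p i) (T12 a (path3 b a p (opp p) k))
    = fscale (T_entry L r a p p) (T12 a (path3 b a i (opp i) k))"
  using assms T_entry_rank_one[OF assms, of _ p i]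
  by (simp add: leg12_T_path3 fun_space.scale_sum_right mult.commute)

lemma T23_path3_proportional:
  assumes "a \<in> Zplus b"
  shows "fscale (T_entry L r (a + sgn_of i) p j) (T23 (path3 b a i p (opp p)))
    = fscale (T_entry L r (a + sgn_of i) p p) (T23 (path3 b a i j (opp j)))"
  using assms T_entry_rank_one[OF Zplus_sgn_of[OF assms, of i], of _ p j]
  by (simp add: leg23_T_path3 fun_space.scale_sum_right mult.commute)

lemma sum_single:
  assumes "\<And>p. p \<noteq> k \<Longrightarrow> g p = 0"
  shows "(\<Sum>p\<in>UNIV. g p) = g (k :: 'n :: finite)"
  using assms by (simp add: sum.remove[of UNIV k])

lemma temperley_lieb_path3:
  fixes i j k :: 2
  assumes a: "a \<in> Zplus b"
  defines "e \<equiv> path3 b a i j k"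
  shows "T12 a (T12 a e) = fscale (kappa_hyp L) (T12 a e)"
    and "T23 (T23 e) = fscale (kappa_hyp L) (T23 e)"
    and "T12 a (T23 (T12 a e)) = T12 a e"
    and "T23 (T12 a (T23 e)) = T23 e"
proof -
  interpret A: Vector_Spaces.linear fscale fscale "T12 a"
    by (intro linear_leg12 linear_op_of_matrix)
  interpret B: Vector_Spaces.linear fscale fscale T23
    by (intro linear_leg23 linear_op_of_matrix)
  have as: "a + sgn_of l \<in> Zplus b" for l using a by simp
  note T12_eq = leg12_T_path3[OF a, of L r] and T23_eq = leg23_T_path3[OF a, of L r]
  have "T12 a (T12 a e) = fscale (kappa_hyp L) (T12 a e) \<and> T12 a (T23 (T12 a e)) = T12 a e"
  proof (cases "j = i")
    case True
    then show ?thesis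
      unfolding e_def T12_eq
      by (simp only: if_True A.zero B.zero fun_space.scale_zero_right simp_thms)
  next
    case False
    then have j: "j = opp i" by (metis opp_simps(5))
    have ex: "T12 a e = (\<Sum>p\<in>UNIV. fscale (T_entry L r a p i) (path3 b a p (opp p) k))"
      unfolding e_def j T12_eq by simp
    have "T12 a (T12 a e) = (\<Sum>p\<in>UNIV. fscale (T_entry L r a p p) (T12 a e))"
      by (subst ex) (simp only: A.sum A.scale T12_path3_proportional[OF a] e_def j)
    then have 1: "T12 a (T12 a e) = fscale (kappa_hyp L) (T12 a e)"
      by (simp only: T_entry_trace[OF a] flip: fun_space.scale_sum_left)
    \<comment> \<open>Of all intermediate paths only \<open>(k, opp k, k)\<close> survives: the middle operator needs its last
      two steps opposite, the outer one its first two.\<close>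
    define t where "t = T_entry L r (a + sgn_of k) (opp k) (opp k)"
    have "T12 a (T23 (T12 a e))
      = (\<Sum>p\<in>UNIV. fscale (T_entry L r a p i) (T12 a (T23 (path3 b a p (opp p) k))))"
      by (subst ex) (simp only: A.sum A.scale B.sum B.scale)
    also have "\<dots> = fscale (T_entry L r a k i) (T12 a (T23 (path3 b a k (opp k) k)))"
    proof (rule sum_single)
      fix p assume "p \<noteq> k"
      then have "k = opp p" by (metis opp_simps(5))
      then have "T23 (path3 b a p (opp p) k) = 0" unfolding T23_eq by simp
      then show "fscale (T_entry L r a p i) (T12 a (T23 (path3 b a p (opp p) k))) = 0"
        by (simp only: A.zero fun_space.scale_zero_right)
    qed
    also have "T12 a (T23 (path3 b a k (opp k) k))
      = (\<Sum>q\<in>UNIV. fscale (T_entry L r (a + sgn_of k) q (opp k)) (T12 a (path3 b a k q (opp q))))"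
      unfolding T23_eq by (simp only: opp_simps if_False A.sum A.scale)
    also have "\<dots> = fscale t (T12 a (path3 b a k (opp k) (opp (opp k))))"
      unfolding t_def
    proof (rule sum_single)
      fix q assume "q \<noteq> opp k"
      then have "q = k" by (metis opp_simps(5))
      then have "T12 a (path3 b a k q (opp q)) = 0" unfolding T12_eq by simp
      then show "fscale (T_entry L r (a + sgn_of k) q (opp k)) (T12 a (path3 b a k q (opp q))) = 0"
        by (simp only: fun_space.scale_zero_right)
    qed
    also have "fscale (T_entry L r a k i) (fscale t (T12 a (path3 b a k (opp k) (opp (opp k)))))
      = fscale t (fscale (T_entry L r a k i) (T12 a (path3 b a k (opp k) k)))"
      by (simp add: mult.commute)
    also have "\<dots> = fscale (t * T_entry L r a k k) (T12 a e)"
      by (simp only: T12_path3_proportional[OF a, of k i k] e_def j fun_space.scale_scale)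
    finally have "T12 a (T23 (T12 a e)) = T12 a e"
      unfolding t_def T_entry_inverse[OF a] by simp
    with 1 show ?thesis by simp
  qed
  then show "T12 a (T12 a e) = fscale (kappa_hyp L) (T12 a e)" "T12 a (T23 (T12 a e)) = T12 a e"
    by auto
  have "T23 (T23 e) = fscale (kappa_hyp L) (T23 e) \<and> T23 (T12 a (T23 e)) = T23 e"
  proof (cases "k = j")
    case True
    then show ?thesis
      unfolding e_def T23_eq
      by (simp only: if_True A.zero B.zero fun_space.scale_zero_right simp_thms)
  next
    case False
    then have k: "k = opp j" by (metis opp_simps(5))
    have ex: "T23 e = (\<Sum>p\<in>UNIV. fscale (T_entry L r (a + sgn_of i) p j) (path3 b a i p (opp p)))"
      unfolding e_def k T23_eq by simp
    have "T23 (T23 e) = (\<Sum>p\<in>UNIV. fscale (T_entry L r (a + sgn_of i) p p) (T23 e))"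
      by (subst ex) (simp only: B.sum B.scale T23_path3_proportional[OF a] e_def k)
    then have 1: "T23 (T23 e) = fscale (kappa_hyp L) (T23 e)"
      by (simp only: T_entry_trace[OF as] flip: fun_space.scale_sum_left)
    \<comment> \<open>Here the surviving intermediate path is \<open>(i, opp i, i)\<close>.\<close>
    define t where "t = T_entry L r a i i"
    have "T23 (T12 a (T23 e))
      = (\<Sum>p\<in>UNIV. fscale (T_entry L r (a + sgn_of i) p j) (T23 (T12 a (path3 b a i p (opp p)))))"
      by (subst ex) (simp only: A.sum A.scale B.sum B.scale)
    also have "\<dots> = fscale (T_entry L r (a + sgn_of i) (opp i) j) (T23 (T12 a (path3 b a i (opp i) (opp (opp i)))))"
    proof (rule sum_single)
      fix p assume "p \<noteq> opp i"
      then have "p = i" by (metis opp_simps(5))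
      then have "T12 a (path3 b a i p (opp p)) = 0" unfolding T12_eq by simp
      then show "fscale (T_entry L r (a + sgn_of i) p j) (T23 (T12 a (path3 b a i p (opp p)))) = 0"
        by (simp only: B.zero fun_space.scale_zero_right)
    qed
    also have "T23 (T12 a (path3 b a i (opp i) (opp (opp i))))
      = (\<Sum>q\<in>UNIV. fscale (T_entry L r a q i) (T23 (path3 b a q (opp q) i)))"
      unfolding T12_eq by (simp only: opp_simps if_False B.sum B.scale)
    also have "\<dots> = fscale t (T23 (path3 b a i (opp i) i))"
      unfolding t_def
    proof (rule sum_single)
      fix q assume "q \<noteq> i"
      then have "i = opp q" by (metis opp_simps(5))
      then have "T23 (path3 b a q (opp q) i) = 0" unfolding T23_eq by simp
      then show "fscale (T_entry L r a q i) (T23 (path3 b a q (opp q) i)) = 0"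
        by (simp only: fun_space.scale_zero_right)
    qed
    also have "fscale (T_entry L r (a + sgn_of i) (opp i) j) (fscale t (T23 (path3 b a i (opp i) i)))
      = fscale t (fscale (T_entry L r (a + sgn_of i) (opp i) j) (T23 (path3 b a i (opp i) (opp (opp i)))))"
      by (simp add: mult.commute)
    also have "\<dots> = fscale (T_entry L r (a + sgn_of i) (opp i) (opp i) * t) (T23 e)"
      by (simp only: T23_path3_proportional[OF a, of i "opp i" j] e_def k fun_space.scale_scale mult.commute)
    finally have "T23 (T12 a (T23 e)) = T23 e"
      unfolding t_def T_entry_inverse[OF a] by simp
    with 1 show ?thesis by simp
  qed
  then show "T23 (T23 e) = fscale (kappa_hyp L) (T23 e)" "T23 (T12 a (T23 e)) = T23 e"
    by auto
qed

lemma temperley_lieb_source_fiber: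
  assumes "\<psi> \<in> source_fiber (line b) (VA3 b) a"
  shows "T12 a (T12 a \<psi>) = fscale (kappa_hyp L) (T12 a \<psi>)"
    and "T23 (T23 \<psi>) = fscale (kappa_hyp L) (T23 \<psi>)"
    and "T12 a (T23 (T12 a \<psi>)) = T12 a \<psi>"
    and "T23 (T12 a (T23 \<psi>)) = T23 \<psi>"
proof -
  interpret A: Vector_Spaces.linear fscale fscale "T12 a"
    by (intro linear_leg12 linear_op_of_matrix)
  interpret B: Vector_Spaces.linear fscale fscale T23
    by (intro linear_leg23 linear_op_of_matrix)
  have "\<psi> \<in> fun_space.span {path3 b a i j k |i j k. a \<in> Zplus b}"
    using assms source_fiber_paths by blast
  then have "T12 a (T12 a \<psi>) = fscale (kappa_hyp L) (T12 a \<psi>) \<and>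
      T23 (T23 \<psi>) = fscale (kappa_hyp L) (T23 \<psi>) \<and>
      T12 a (T23 (T12 a \<psi>)) = T12 a \<psi> \<and> T23 (T12 a (T23 \<psi>)) = T23 \<psi>"
  proof (induction rule: fun_space.span_induct_alt)
    case base
    show ?case by (simp only: A.zero B.zero fun_space.scale_zero_right simp_thms)
  next
    case (step c x y)
    from step(1) obtain i j k where "a \<in> Zplus b" "x = path3 b a i j k" by blast
    then show ?case
      using step(2)
      by (simp only: A.add B.add A.scale B.scale temperley_lieb_path3 fun_space.scale_right_distrib
          fun_space.scale_left_commute simp_thms)
  qed
  then show "T12 a (T12 a \<psi>) = fscale (kappa_hyp L) (T12 a \<psi>)"
    "T23 (T23 \<psi>) = fscale (kappa_hyp L) (T23 \<psi>)"
    "T12 a (T23 (T12 a \<psi>)) = T12 a \<psi>" "T23 (T12 a (T23 \<psi>)) = T23 \<psi>"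
    by auto
qed

end

theorem lemma2p29:
  fixes L :: nat and b :: complex and r :: "complex \<Rightarrow> complex"
  assumes L: "L \<ge> 2"
    and generic_b: "\<forall>a\<in>Zplus b. hbr L a \<noteq> 0"
    and root: "\<forall>a\<in>Zplus b. (r a)\<^sup>2 = hbr L (a - 1) * hbr L (a + 1)"
  shows "(\<forall>z z' z''. z'' = z' - z \<longrightarrow>
            hbr L (1 - z) \<noteq> 0 \<longrightarrow> hbr L (1 - z') \<noteq> 0 \<longrightarrow> hbr L (1 - z'') \<noteq> 0 \<longrightarrow>
            (let x = f_hyp L z; x' = f_hyp L z'; x'' = f_hyp L z'' in
               1 + kappa_hyp L * x + x * x' \<noteq> 0 \<and>
               x'' = (x' - x) / (1 + kappa_hyp L * x + x * x')))
       \<and> (\<forall>a\<in>Zplus b. \<forall>z w.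
            hbr L (1 - z) \<noteq> 0 \<longrightarrow> hbr L (1 - w) \<noteq> 0 \<longrightarrow> hbr L (1 - (z - w)) \<noteq> 0 \<longrightarrow>
            (\<forall>\<psi>\<in>source_fiber (line b) (VA3 b) a.
               (leg23 (R_hyp L r b (z - w)) \<circ> leg12 (R_hyp L r b z a) \<circ> leg23 (R_hyp L r b w)) \<psi>
             = (leg12 (R_hyp L r b w a) \<circ> leg23 (R_hyp L r b z) \<circ> leg12 (R_hyp L r b (z - w) a)) \<psi>))"
proof (intro conjI ballI allI impI)
  fix z z' z'' :: complex
  assume "z'' = z' - z" "hbr L (1 - z) \<noteq> 0" "hbr L (1 - z') \<noteq> 0" "hbr L (1 - z'') \<noteq> 0"
  then show "let x = f_hyp L z; x' = f_hyp L z'; x'' = f_hyp L z'' in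
      1 + kappa_hyp L * x + x * x' \<noteq> 0 \<and> x'' = (x' - x) / (1 + kappa_hyp L * x + x * x')"
    using f_hyp_diff[of L z z'] unfolding Let_def by simp
next
  fix a z w \<psi>
  assume nz: "hbr L (1 - z) \<noteq> 0" "hbr L (1 - w) \<noteq> 0" "hbr L (1 - (z - w)) \<noteq> 0"
    and \<psi>: "\<psi> \<in> source_fiber (line b) (VA3 b) a"
  note TL = temperley_lieb_source_fiber[OF generic_b root \<psi>]
  have "f_hyp L (z - w) * (1 + kappa_hyp L * f_hyp L w + f_hyp L w * f_hyp L z)
      = f_hyp L z - f_hyp L w"
    using f_hyp_diff[OF nz(2,1,3)] by simp
  then have "f_hyp L (z - w) + f_hyp L w + kappa_hyp L * f_hyp L (z - w) * f_hyp L w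
      + f_hyp L (z - w) * f_hyp L z * f_hyp L w = f_hyp L z"
    by (simp add: algebra_simps)
  then show "(leg23 (R_hyp L r b (z - w)) \<circ> leg12 (R_hyp L r b z a) \<circ> leg23 (R_hyp L r b w)) \<psi>
      = (leg12 (R_hyp L r b w a) \<circ> leg23 (R_hyp L r b z) \<circ> leg12 (R_hyp L r b (z - w) a)) \<psi>"
    unfolding comp_apply leg12_R_hyp leg23_R_hyp
    by (rule temperley_lieb_yang_baxter[OF linear_leg12[OF linear_op_of_matrix]
          linear_leg23[OF linear_op_of_matrix] TL])
qed

end
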